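(* For every $n\ge 1$, the map $pre_2$ is injective on the set of partitions of $n$ with exactly four parts, on the set of partitions of $n$ with exactly five parts, and on the set of partitions of $n$ with exactly six parts.
   Context: A partition $\lambda=(\lambda_1,\dots,\lambda_\ell)$ of $n$ is a non-increasing sequence of positive integers summing to $n$; $\ell$ is its number of parts. $pre_2(\lambda)$ is the partition whose multiset of parts is $\{\lambda_i\lambda_j : 1\le i<j\le \ell\}$ if $\ell\ge 2$, and is the empty partition if $\ell<2$. *)

theory Defs
  imports "HOL-Library.Multiset"
begin

definition is_partition :: "nat list \<Rightarrow> nat \<Rightarrow> bool" where
  "is_partition l n \<longleftrightarrow> sorted_wrt (\<ge>) l \<and> (\<forall>x \<in> set l. 0 < x) \<and> sum_list l = n"

definition partitions_with_parts :: "nat \<Rightarrow> nat \<Rightarrow> nat list set" where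
  "partitions_with_parts n k = {l. is_partition l n \<and> length l = k}"

text \<open>Products are indexed by pairs of positions (counted from 0), so multiplicities are kept.\<close>

definition pair_products :: "nat list \<Rightarrow> nat multiset" where
  "pair_products l =
    image_mset (\<lambda>(i, j). l ! i * l ! j) (mset_set {(i, j). i < j \<and> j < length l})"

text \<open>The sorted list of a multiset is increasing, whereas partitions are non-increasing;
  hence the reversal.\<close>

definition pre2 :: "nat list \<Rightarrow> nat list" where
  "pre2 l = (if 2 \<le> length l then rev (sorted_list_of_multiset (pair_products l)) else [])"

lemma finite_index_pairs: "finite {(i, j). i < j \<and> j < (m::nat)}"
  by (rule finite_subset[of _ "{..<m} \<times> {..<m}"]) auto

lemma mset_pre2: "2 \<le> length l \<Longrightarrow> mset (pre2 l) = pair_products l"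
  by (simp add: pre2_def)

lemma is_partition_pre2:
  assumes "is_partition l n"
  shows "is_partition (pre2 l) (sum_list (pre2 l))"
proof (cases "2 \<le> length l")
  case True
  have "0 < x" if "x \<in># pair_products l" for x
    using that assms finite_index_pairs[of "length l"]
    by (auto simp: pair_products_def is_partition_def)
  then show ?thesis
    using True by (simp add: is_partition_def pre2_def sorted_wrt_rev)
next
  case False
  then show ?thesis by (simp add: is_partition_def pre2_def)
qed

end

(* Passing to logarithms, pre2 becomes the multiset of pairwise sums of l real numbers. The k-th
   power sum of the pairwise sums equals (l - 2^(k-1)) p_k plus an expression in p_1, ..., p_(k-1),
   where p_k is the k-th power sum of the numbers. So unless l is a power of 2 (Selfridge and
   Straus) all the p_k, hence the numbers, are determined; this covers l = 5 and l = 6.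

   For l = 4, write d >= c >= b >= a. All entries of pre2 are known up to the order of d a and c b.
   Two partitions agreeing on this order coincide. Otherwise the second one is
   (r d, c / r, b / r, r a), and equality of the sums forces r = 1 or r (a + d) = b + c; in the
   latter case both partitions have the same parts. *)

theory Submission
  imports Defs "HOL-Computational_Algebra.Polynomial"
begin

section \<open>Power sums determine a multiset\<close>

lemma sum_mset_poly:
  fixes A :: "'a::comm_semiring_1 multiset"
  shows "(\<Sum>x\<in>#A. poly q x) = (\<Sum>i\<le>degree q. coeff q i * (\<Sum>x\<in>#A. x ^ i))"
  by (induction A) (simp_all add: poly_altdef sum.distrib distrib_left)

text \<open>Equal power sums give equal sums of every polynomial. Choosing \<open>q\<close> to
  vanish at all entries other than \<open>z\<close> isolates the multiplicity of \<open>z\<close>,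
  which characteristic 0 lets one read off.\<close>

lemma mset_eq_of_power_sums:
  fixes A B :: "'a::field_char_0 multiset"
  assumes "\<And>k. (\<Sum>x\<in>#A. x ^ k) = (\<Sum>x\<in>#B. x ^ k)"
  shows "A = B"
proof (rule multiset_eqI)
  fix z
  define S where "S = (set_mset A \<union> set_mset B) - {z}"
  define q where "q = (\<Prod>y\<in>S. [:- y, 1:])"
  have fin: "finite S" by (simp add: S_def)
  have q_S: "poly q x = 0" if "x \<in> S" for x
    using that fin by (auto simp: q_def poly_prod)
  have q_z: "poly q z \<noteq> 0"
    using fin by (auto simp: q_def poly_prod S_def)
  have *: "(\<Sum>x\<in>#C. poly q x) = of_nat (count C z) * poly q z"
    if "set_mset C \<subseteq> insert z S" for C
    using that by (induction C) (auto simp: q_S algebra_simps)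
  have "(\<Sum>x\<in>#A. poly q x) = (\<Sum>x\<in>#B. poly q x)"
    by (simp only: sum_mset_poly assms)
  moreover have "set_mset A \<subseteq> insert z S" "set_mset B \<subseteq> insert z S"
    by (auto simp: S_def)
  ultimately show "count A z = count B z"
    using q_z by (simp add: *)
qed

section \<open>Power sums of pairwise sums\<close>

lemma sum_upper_triangle:
  fixes g :: "nat \<Rightarrow> nat \<Rightarrow> 'a::comm_semiring_1"
  assumes "\<And>i j. g i j = g j i"
  shows "2 * (\<Sum>(i, j)\<in>{(i, j). i < j \<and> j < n}. g i j) + (\<Sum>i<n. g i i) =
    (\<Sum>i<n. \<Sum>j<n. g i j)"
proof (induction n)
  case (Suc n)
  have "{(i, j). i < j \<and> j < Suc n} = {(i, j). i < j \<and> j < n} \<union> (\<lambda>i. (i, n)) ` {..<n}"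
    by (auto simp: less_Suc_eq)
  moreover have "(\<Sum>(i, j)\<in>(\<lambda>i. (i, n)) ` {..<n}. g i j) = (\<Sum>i<n. g i n)"
    by (subst sum.reindex) (auto simp: inj_on_def)
  ultimately have "(\<Sum>(i, j)\<in>{(i, j). i < j \<and> j < Suc n}. g i j) =
      (\<Sum>(i, j)\<in>{(i, j). i < j \<and> j < n}. g i j) + (\<Sum>i<n. g i n)"
    by (simp, subst sum.union_disjoint) (auto simp: finite_index_pairs)
  moreover have "(\<Sum>j<n. g n j) = (\<Sum>i<n. g i n)"
    by (simp add: assms[of n])
  ultimately show ?case
    using Suc.IH by (simp add: sum.distrib algebra_simps mult_2)
qed simp

text \<open>Summing over all ordered pairs counts each pair \<open>i < j\<close> twice and adds the
  diagonal terms \<open>(2 * y i) ^ k\<close>. The binomial theorem then separates the two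
  indices.\<close>

lemma power_sum_pair_sums:
  fixes y :: "nat \<Rightarrow> 'a::comm_semiring_1"
  shows "2 * (\<Sum>(i, j)\<in>{(i, j). i < j \<and> j < n}. (y i + y j) ^ k) + 2 ^ k * (\<Sum>i<n. y i ^ k) =
    (\<Sum>m\<le>k. of_nat (k choose m) * (\<Sum>i<n. y i ^ m) * (\<Sum>i<n. y i ^ (k - m)))"
proof -
  have "2 * (\<Sum>(i, j)\<in>{(i, j). i < j \<and> j < n}. (y i + y j) ^ k) + (\<Sum>i<n. (y i + y i) ^ k) =
      (\<Sum>i<n. \<Sum>j<n. (y i + y j) ^ k)"
    by (rule sum_upper_triangle) (simp add: add.commute)
  also have "\<dots> = (\<Sum>i<n. \<Sum>j<n. \<Sum>m\<le>k. of_nat (k choose m) * y i ^ m * y j ^ (k - m))"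
    by (simp add: binomial_ring)
  also have "\<dots> = (\<Sum>i<n. \<Sum>m\<le>k. \<Sum>j<n. of_nat (k choose m) * y i ^ m * y j ^ (k - m))"
    by (intro sum.cong refl sum.swap)
  also have "\<dots> = (\<Sum>m\<le>k. \<Sum>i<n. \<Sum>j<n. of_nat (k choose m) * y i ^ m * y j ^ (k - m))"
    by (rule sum.swap)
  also have "\<dots> = (\<Sum>m\<le>k. of_nat (k choose m) * (\<Sum>i<n. y i ^ m) * (\<Sum>i<n. y i ^ (k - m)))"
    by (simp add: sum_product mult.assoc flip: sum_distrib_left)
  finally show ?thesis
    by (simp add: mult_2[symmetric] power_mult_distrib sum_distrib_left)
qed

lemma power_sums_eq_of_pair_sums:
  fixes y z :: "nat \<Rightarrow> 'a::field_char_0"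
  assumes pairs: "\<And>k. (\<Sum>(i, j)\<in>{(i, j). i < j \<and> j < n}. (y i + y j) ^ k) =
      (\<Sum>(i, j)\<in>{(i, j). i < j \<and> j < n}. (z i + z j) ^ k)"
    and n: "\<And>k. n \<noteq> 2 ^ k"
  shows "(\<Sum>i<n. y i ^ k) = (\<Sum>i<n. z i ^ k)"
proof (induction k rule: less_induct)
  case (less k)
  show ?case
  proof (cases k)
    case (Suc k')
    \<comment> \<open>The middle terms of the binomial expansion: both \<open>m\<close> and
      \<open>k - m\<close> are below \<open>k\<close>, so the induction hypothesis applies to each
      factor.\<close>
    define S where "S x = (\<Sum>m\<in>{0<..<k}. of_nat (k choose m) *
      (\<Sum>i<n. x i ^ m) * (\<Sum>i<n. x i ^ (k - m)))" for x :: "nat \<Rightarrow> 'a"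
    \<comment> \<open>The end terms \<open>m = 0\<close> and \<open>m = k\<close> contribute
      \<open>n\<close> times the k-th power sum each, the diagonal takes away \<open>2 ^ k\<close>
      times it.\<close>
    have *: "2 * (\<Sum>(i, j)\<in>{(i, j). i < j \<and> j < n}. (x i + x j) ^ k) - S x =
        (of_nat (2 * n) - 2 ^ k) * (\<Sum>i<n. x i ^ k)" for x :: "nat \<Rightarrow> 'a"
    proof -
      have "{..k} = insert 0 (insert k {0<..<k})"
        using Suc by auto
      then have "(\<Sum>m\<le>k. of_nat (k choose m) * (\<Sum>i<n. x i ^ m) * (\<Sum>i<n. x i ^ (k - m))) =
          2 * of_nat n * (\<Sum>i<n. x i ^ k) + S x"
        using Suc by (simp add: S_def)
      then show ?thesis
        using power_sum_pair_sums[where y = x and n = n and k = k] by (simp add: algebra_simps)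
    qed
    have "S y = S z"
      unfolding S_def by (intro sum.cong) (use less in auto)
    then have "(of_nat (2 * n) - 2 ^ k) * (\<Sum>i<n. y i ^ k) =
        (of_nat (2 * n) - 2 ^ k) * (\<Sum>i<n. z i ^ k)"
      by (simp only: *[symmetric] pairs)
    \<comment> \<open>Since \<open>k = Suc k'\<close>, equality would mean
      \<open>n = 2 ^ k'\<close>.\<close>
    moreover have "of_nat (2 * n) \<noteq> (of_nat (2 ^ k) :: 'a)"
      using n[of k'] unfolding of_nat_eq_iff by (simp add: Suc)
    ultimately show ?thesis by simp
  qed simp
qed

section \<open>From products to sums by logarithms\<close>

lemma sum_mset_mset_eq_sum_nth:
  "(\<Sum>x\<in>#mset xs. f x) = (\<Sum>i<length xs. f (xs ! i))"
  by (induction xs) (simp_all add: sum.lessThan_Suc_shift del: sum.lessThan_Suc)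

lemma mset_eq_of_pair_products:
  assumes len: "length xs = n" "length ys = n" and n: "\<And>k. n \<noteq> 2 ^ k"
    and pos: "\<forall>x\<in>set xs. 0 < x" "\<forall>y\<in>set ys. 0 < y"
    and eq: "pair_products xs = pair_products ys"
  shows "mset xs = mset ys"
proof -
  have ln_pairs: "(\<Sum>x\<in>#pair_products zs. ln (real x) ^ k) =
      (\<Sum>(i, j)\<in>{(i, j). i < j \<and> j < n}. (ln (real (zs ! i)) + ln (real (zs ! j))) ^ k)"
    if "\<forall>z\<in>set zs. 0 < z" "length zs = n" for zs k
  proof -
    have "(\<Sum>x\<in>#pair_products zs. ln (real x) ^ k) =
        (\<Sum>(i, j)\<in>{(i, j). i < j \<and> j < n}. ln (real (zs ! i * zs ! j)) ^ k)"
      by (simp add: pair_products_def that(2) image_mset.compositionality o_def case_prod_beta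
          sum_unfold_sum_mset)
    also have "\<dots> =
        (\<Sum>(i, j)\<in>{(i, j). i < j \<and> j < n}. (ln (real (zs ! i)) + ln (real (zs ! j))) ^ k)"
      using that by (intro sum.cong) (auto simp: ln_mult)
    finally show ?thesis .
  qed
  have "(\<Sum>i<n. ln (real (xs ! i)) ^ k) = (\<Sum>i<n. ln (real (ys ! i)) ^ k)" for k
    using n by (intro power_sums_eq_of_pair_sums) (simp_all add: eq len pos flip: ln_pairs)
  then have "image_mset (\<lambda>x. ln (real x)) (mset xs) = image_mset (\<lambda>x. ln (real x)) (mset ys)"
    by (intro mset_eq_of_power_sums)
      (simp add: image_mset.compositionality o_def sum_mset_mset_eq_sum_nth len del: mset_map)
  \<comment> \<open>\<open>nat \<lfloor>exp t\<rfloor>\<close> undoes \<open>ln\<close> on positive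
    naturals, so it recovers the parts themselves.\<close>
  then have "image_mset (\<lambda>t. nat \<lfloor>exp t\<rfloor>) (image_mset (\<lambda>x. ln (real x)) (mset xs)) =
      image_mset (\<lambda>t. nat \<lfloor>exp t\<rfloor>) (image_mset (\<lambda>x. ln (real x)) (mset ys))"
    by (rule arg_cong)
  moreover have "image_mset (\<lambda>t. nat \<lfloor>exp t\<rfloor>) (image_mset (\<lambda>x. ln (real x)) (mset zs)) = mset zs"
    if "\<forall>z\<in>set zs. 0 < z" for zs
    using that by (induction zs) auto
  ultimately show ?thesis
    using pos by simp
qed

lemma eq_of_mset_eq_partitions:
  assumes "is_partition l n" "is_partition l' n'" "mset l = mset l'"
  shows "l = l'"
proof -
  have "sort (rev l') = rev l" "sort (rev l') = rev l'"
    using assms by (auto simp: is_partition_def sorted_wrt_rev intro!: properties_for_sort)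
  then show ?thesis by simp
qed

lemma inj_on_pre2_not_power_of_2:
  assumes "2 \<le> k" "\<And>m. k \<noteq> 2 ^ m"
  shows "inj_on pre2 (partitions_with_parts n k)"
proof (rule inj_onI)
  fix l l'
  assume l: "l \<in> partitions_with_parts n k" and l': "l' \<in> partitions_with_parts n k"
    and eq: "pre2 l = pre2 l'"
  have "pair_products l = pair_products l'"
    using l l' assms(1) mset_pre2[of l] mset_pre2[of l'] eq
    by (simp add: partitions_with_parts_def)
  then have "mset l = mset l'"
    using l l' assms(2)
    by (intro mset_eq_of_pair_products[of _ k]) (auto simp: partitions_with_parts_def is_partition_def)
  then show "l = l'"
    using l l' by (auto simp: partitions_with_parts_def intro: eq_of_mset_eq_partitions)
qed

section \<open>Partitions with four parts\<close>

lemma pre2_four: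
  assumes "a \<le> b" "b \<le> c" "c \<le> d"
  shows "pre2 [d, c, b, a] =
    [d * c, d * b, max (d * a) (c * b), min (d * a) (c * b), c * a, b * a]"
proof -
  have idx: "{(i, j). i < j \<and> j < Suc (Suc (Suc (Suc 0)))} =
      {(0, 1), (0, 2), (0, 3), (1, 2), (1, 3), (2, 3)}"
    by auto
  define L where
    "L = rev [d * c, d * b, max (d * a) (c * b), min (d * a) (c * b), c * a, b * a]"
  have "pair_products [d, c, b, a] = {#d * c, d * b, d * a, c * b, c * a, b * a#}"
    by (simp add: pair_products_def idx)
  also have "\<dots> = mset L"
    by (simp add: L_def max_def min_def)
  finally have "pair_products [d, c, b, a] = mset L" .
  \<comment> \<open>Only \<open>d * a\<close> and \<open>c * b\<close> remain incomparable, hence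
    the \<open>max\<close> and \<open>min\<close>.\<close>
  moreover have "d * b \<le> d * c" "d * a \<le> d * b" "c * b \<le> d * b" "c * a \<le> d * a"
      "c * a \<le> c * b" "b * a \<le> c * a"
    using assms by simp_all
  then have "sorted L"
    unfolding L_def by (simp add: sorted2_simps del: sorted_wrt.simps)
  ultimately have "pre2 [d, c, b, a] = rev L"
    by (simp add: pre2_def sorted_list_of_multiset_mset sorted_sort_id)
  then show ?thesis
    by (simp add: L_def)
qed

text \<open>The product of \<open>d * c\<close> and \<open>d * b\<close> is \<open>c * b\<close>
  times the square of \<open>d\<close>; as \<open>c * b\<close> is known and positive,
  \<open>d\<close> is determined, and cancelling it gives the other parts.\<close>

lemma four_parts_same_order:
  fixes a b c d a' b' c' d' :: nat
  assumes "0 < a" "0 < b" "0 < c" "0 < d"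
    and "d * c = d' * c'" "d * b = d' * b'" "d * a = d' * a'" "c * b = c' * b'"
  shows "[d, c, b, a] = [d', c', b', a']"
proof -
  have "d\<^sup>2 * (c * b) = (d * c) * (d * b)"
    by (simp add: power2_eq_square)
  also have "\<dots> = d'\<^sup>2 * (c * b)"
    by (simp add: power2_eq_square assms(5,6,8))
  finally have "d = d'"
    using assms(1-4,8) by auto
  then show ?thesis
    using assms by simp
qed

lemma four_parts_opposite_order:
  fixes a b c d a' b' c' d' :: nat
  assumes pos: "0 < a" "0 < b" "0 < c" "0 < d"
    and le: "a \<le> b" "b \<le> c" "c \<le> d" and le': "a' \<le> b'" "b' \<le> c'" "c' \<le> d'"
    and eqs: "d * c = d' * c'" "d * b = d' * b'" "d * a = c' * b'" "c * b = d' * a'"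
      "c * a = c' * a'" "b * a = b' * a'"
    and sum: "d + c + b + a = d' + c' + b' + a'"
  shows "[d, c, b, a] = [d', c', b', a']"
proof -
  have pos': "0 < c'" "0 < b'" "0 < d'" "0 < a'"
    using eqs pos by (auto intro!: Nat.gr0I)
  \<comment> \<open>The ratios \<open>d' / d\<close> and \<open>a' / a\<close> both equal
    \<open>c / c'\<close>; cross-multiplying avoids division.\<close>
  have "(a * d') * (c * c') = (a' * d) * (c * c')"
    using eqs(1,5) by (metis mult.assoc mult.commute)
  then have ad: "int a * int d' = int a' * int d"
    using pos pos' by (simp flip: of_nat_mult)
  have e: "int d * int c = int d' * int c'" "int d * int b = int d' * int b'"
      "int d * int a = int c' * int b'"
    using eqs by (simp_all flip: of_nat_mult)
  have s: "int d + int c + int b + int a = int d' + int c' + int b' + int a'"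
    using sum by linarith
  \<comment> \<open>Expanding the left side and replacing \<open>d' * b'\<close>,
    \<open>d' * c'\<close> and \<open>a * d'\<close> makes \<open>d\<close> a common factor, leaving
    the difference of the two sums. Integers are used because natural subtraction truncates.\<close>
  have "(int d' - int d) * (int b' + int c' - int a - int d) =
      int d * ((int d + int c + int b + int a) - (int d' + int c' + int b' + int a'))"
    using e(1,2) ad by (simp add: algebra_simps)
  then have "(int d' - int d) * (int b' + int c' - int a - int d) = 0"
    by (simp add: s)
  then consider "d = d'" | "int b' + int c' = int a + int d" by auto
  then show ?thesis
  proof cases
    case 1
    then show ?thesis using eqs pos pos' by auto
  next
    case 2
    then have b': "int b' = int a + int d - int c'" by simp
    \<comment> \<open>Now \<open>b'\<close> and \<open>c'\<close> have the same sum and product as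
      \<open>a\<close> and \<open>d\<close>, so they are the same pair, in an order fixed by
      monotonicity.\<close>
    have "(int c' - int d) * (int c' - int a) = 0"
      using e(3) unfolding b' by (simp add: algebra_simps)
    then have "c' = d \<and> b' = a"
      using 2 le le' by auto
    \<comment> \<open>Here \<open>d' = c\<close> and then \<open>a' = b\<close> from the sum. The
      orderings give \<open>d = c' \<le> d' = c\<close> and \<open>b = a' \<le> b' = a\<close>, so
      \<open>c = d\<close> and \<open>a = b\<close>.\<close>
    then show ?thesis
      using eqs(1) pos' le le' sum by auto
  qed
qed

lemma inj_on_pre2_four: "inj_on pre2 (partitions_with_parts n 4)"
proof (rule inj_onI)
  fix l l'
  assume l: "l \<in> partitions_with_parts n 4" and l': "l' \<in> partitions_with_parts n 4"
    and eq: "pre2 l = pre2 l'"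
  have four: "\<exists>d c b a. l = [d, c, b, a]" if "l \<in> partitions_with_parts n 4" for l
    using that by (auto simp: partitions_with_parts_def numeral_eq_Suc length_Suc_conv)
  obtain d c b a where abcd: "l = [d, c, b, a]"
    using four[OF l] by blast
  obtain d' c' b' a' where abcd': "l' = [d', c', b', a']"
    using four[OF l'] by blast
  have le: "a \<le> b" "b \<le> c" "c \<le> d" and pos: "0 < a" "0 < b" "0 < c" "0 < d"
    and le': "a' \<le> b'" "b' \<le> c'" "c' \<le> d'"
    and sum: "d + c + b + a = d' + c' + b' + a'"
    using l l' by (auto simp: partitions_with_parts_def is_partition_def abcd abcd')
  have outer: "d * c = d' * c'" "d * b = d' * b'" "c * a = c' * a'" "b * a = b' * a'"
    and inner: "max (d * a) (c * b) = max (d' * a') (c' * b')"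
      "min (d * a) (c * b) = min (d' * a') (c' * b')"
    using eq by (simp_all add: abcd abcd' pre2_four le le')
  \<comment> \<open>Equal maximum and minimum mean that the two middle products agree as an
    unordered pair.\<close>
  consider "d * a = d' * a'" "c * b = c' * b'" | "d * a = c' * b'" "c * b = d' * a'"
    using inner by (auto simp: max_def min_def split: if_splits)
  then show "l = l'"
    unfolding abcd abcd'
  proof cases
    case 1
    then show "[d, c, b, a] = [d', c', b', a']"
      using four_parts_same_order pos outer by blast
  next
    case 2
    then show "[d, c, b, a] = [d', c', b', a']"
      using four_parts_opposite_order pos le le' outer sum by blast
  qed
qed

theorem theorem1p6:
  fixes n :: nat
  assumes "1 \<le> n"
  shows "inj_on pre2 (partitions_with_parts n 4)
    \<and> inj_on pre2 (partitions_with_parts n 5)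
    \<and> inj_on pre2 (partitions_with_parts n 6)"
proof (intro conjI)
  have *: "k \<noteq> 2 ^ m" if "4 < k" "k < 8" for k m :: nat
  proof
    assume "k = 2 ^ m"
    \<comment> \<open>The exponent would lie strictly between 2 and 3.\<close>
    then have "(2::nat) ^ 2 < 2 ^ m" "(2::nat) ^ m < 2 ^ 3"
      using that by simp_all
    then show False
      by (simp only: power_strict_increasing_iff)
  qed
  show "inj_on pre2 (partitions_with_parts n 5)" "inj_on pre2 (partitions_with_parts n 6)"
    by (rule inj_on_pre2_not_power_of_2; use * in simp)+
qed (rule inj_on_pre2_four)

end
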